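(* Let $m\ge 1$ and $n\ge 3$ be integers, let $a,d,\hat\mu\in\mathbb{R}$ with $\hat\mu>0$, let $A\in\mathbb{R}^{m\times m}$, and let $\vec b,\vec e,h_Y\in\mathbb{R}^{m}$. Consider the piecewise linear map $(x,Y)\mapsto (f(x),G(x,Y))$ on $\mathbb{R}\times\mathbb{R}^m$ given by $$f(x)=\begin{cases} a x+\hat\mu, & x\le 0\\ d x+\hat\mu, & x\ge 0\end{cases},\qquad G(x,Y)=\begin{cases}\vec b\,x+AY+h_Y, & x\le 0\\ \vec e\,x+AY+h_Y, & x\ge 0.\end{cases}$$ If all eigenvalues of $A$ are smaller than $1$ in modulus, then the stability of the $n$-cycle $\mathcal{O}_{RL^{n-1}}$ is determined by the one-dimensional map $f$, in the sense that the $n$-cycle $\mathcal{O}_{RL^{n-1}}$ of the map $(x,Y)\mapsto(f(x),G(x,Y))$ is attracting if $(a,d)$ belongs to the parametric region $$\mathcal{R}_s^{RL^{n-1}}=\left\{(a,d)\in\mathbb{R}^2\;\Big|\; a>0,\ -\frac{1}{a^{n-1}}<d<-\frac{1-a^{n-1}}{(1-a)a^{n-2}}\right\}.$$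
   Context: The quotient $\frac{1-a^{n-1}}{1-a}$ denotes $1+a+\dots+a^{n-2}$ (in particular it equals $n-1$ when $a=1$). $\mathcal{O}_{RL^{n-1}}$ denotes the $n$-cycle with symbolic sequence $RL^{n-1}$: a periodic orbit $Z_1\mapsto Z_2\mapsto\cdots\mapsto Z_n\mapsto Z_1$, $Z_i=(x_i,Y_i)\in\mathbb{R}\times\mathbb{R}^m$, with $x_1>0$ and $x_2,\dots,x_n<0$. A cycle is attracting if it is a (locally) asymptotically stable periodic orbit of the map. *)

theory Defs
  imports "HOL-Analysis.Analysis"
begin

(* Eigenvalues of a real matrix are taken over the complex numbers. *)
definition complex_eigenvalue :: "real^'m^'m \<Rightarrow> complex \<Rightarrow> bool" where
  "complex_eigenvalue A z \<longleftrightarrow>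
     (\<exists>v :: complex^'m. v \<noteq> 0 \<and> map_matrix complex_of_real A *v v = z *s v)"

(* The two branches of pl_f, and those of pl_G, agree at x = 0. *)
definition pl_f :: "real \<Rightarrow> real \<Rightarrow> real \<Rightarrow> real \<Rightarrow> real" where
  "pl_f a d \<mu> x = (if x \<le> 0 then a * x + \<mu> else d * x + \<mu>)"

definition pl_G :: "real^'m^'m \<Rightarrow> real^'m \<Rightarrow> real^'m \<Rightarrow> real^'m \<Rightarrow> real \<Rightarrow> real^'m \<Rightarrow> real^'m" where
  "pl_G A b e h x Y = (if x \<le> 0 then x *\<^sub>R b + A *v Y + h else x *\<^sub>R e + A *v Y + h)"

definition pl_map ::
  "real \<Rightarrow> real \<Rightarrow> real \<Rightarrow> real^'m^'m \<Rightarrow> real^'m \<Rightarrow> real^'m \<Rightarrow> real^'m \<Rightarrow>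
   real \<times> (real^'m) \<Rightarrow> real \<times> (real^'m)" where
  "pl_map a d \<mu> A b e h = (\<lambda>(x, Y). (pl_f a d \<mu> x, pl_G A b e h x Y))"

(* The points Z 1, ..., Z n form an n-cycle with symbolic sequence R L^(n-1);
   values of Z outside {1..n} are irrelevant. For n \<ge> 1 the sign pattern forces
   n to be the least period. *)
definition RL_cycle ::
  "(real \<times> 'b \<Rightarrow> real \<times> 'b) \<Rightarrow> nat \<Rightarrow> (nat \<Rightarrow> real \<times> 'b) \<Rightarrow> bool" where
  "RL_cycle T n Z \<longleftrightarrow>
     (\<forall>i\<in>{1..<n}. T (Z i) = Z (i + 1)) \<and> T (Z n) = Z 1 \<and>
     fst (Z 1) > 0 \<and> (\<forall>i\<in>{2..n}. fst (Z i) < 0)"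

definition lyapunov_stable :: "('p::metric_space \<Rightarrow> 'p) \<Rightarrow> 'p set \<Rightarrow> bool" where
  "lyapunov_stable T S \<longleftrightarrow>
     (\<forall>\<epsilon>>0. \<exists>\<delta>>0. \<forall>p. infdist p S < \<delta> \<longrightarrow> (\<forall>k. infdist ((T ^^ k) p) S < \<epsilon>))"

definition locally_attractive :: "('p::metric_space \<Rightarrow> 'p) \<Rightarrow> 'p set \<Rightarrow> bool" where
  "locally_attractive T S \<longleftrightarrow>
     (\<exists>\<eta>>0. \<forall>p. infdist p S < \<eta> \<longrightarrow> (\<lambda>k. infdist ((T ^^ k) p) S) \<longlonglongrightarrow> 0)"

(* Meant for nonempty S: infdist p {} = 0. *)
definition asymptotically_stable :: "('p::metric_space \<Rightarrow> 'p) \<Rightarrow> 'p set \<Rightarrow> bool" where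
  "asymptotically_stable T S \<longleftrightarrow> lyapunov_stable T S \<and> locally_attractive T S"

(* The geometric sum is the quotient (1 - a^(n-1)) / (1 - a), with value n - 1 at a = 1. *)
definition RL_stability_region :: "nat \<Rightarrow> (real \<times> real) set" where
  "RL_stability_region n =
     {(a, d). a > 0 \<and> - (1 / a ^ (n - 1)) < d \<and>
        d < - ((\<Sum>k\<le>n - 2. a ^ k) / a ^ (n - 2))}"

end

theory Submission
  imports Defs "HOL-Computational_Algebra.Fundamental_Theorem_Algebra"
begin

text \<open>
  Near the cycle the map is affine on each of the \<open>n\<close> pieces, and its linear part is block
  triangular: the first coordinate is multiplied by \<open>a\<close> or \<open>d\<close>, so by
  \<open>a ^ (n - 1) * d \<in> (-1, 0)\<close> over a full period, and the second coordinate follows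
  \<open>Y \<mapsto> A Y\<close> up to a forcing proportional to the first. As \<open>A\<close> has spectral radius less
  than one, a forcing that tends to zero gives an orbit that tends to zero, so every product of
  linear parts along the cycle tends to zero pointwise. In finite dimension these products are
  therefore uniformly bounded, so orbits that start close enough to the cycle never leave the
  region where the affine description is valid.

  The cycle exists because the closing equation for \<open>x\<close> is scalar and that for \<open>Y\<close> has the
  invertible matrix \<open>I - A ^ n\<close>.
\<close>

section \<open>Scalar contractions with vanishing forcing\<close>

lemma contractive_recurrence_tendsto_0:
  fixes s g :: "nat \<Rightarrow> real"
  assumes nn: "\<And>k. 0 \<le> s k" and q: "0 \<le> q" "q < 1"
    and rec: "\<And>k. s (Suc k) \<le> q * s k + g k" and g: "g \<longlonglongrightarrow> 0"
  shows "s \<longlonglongrightarrow> 0"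
proof (rule LIMSEQ_I)
  fix \<epsilon> :: real assume e: "\<epsilon> > 0"
  \<comment> \<open>With this \<open>\<eta>\<close>, \<open>\<epsilon> / 2\<close> is the fixed
    point of \<open>t \<mapsto> q * t + \<eta>\<close>, so from \<open>K\<close> on the excess of
    \<open>s\<close> over it is bounded by a geometric sequence.\<close>
  define \<eta> where "\<eta> = (1 - q) * (\<epsilon> / 2)"
  have "\<eta> > 0" using e q by (simp add: \<eta>_def)
  then obtain K where K: "\<And>k. k \<ge> K \<Longrightarrow> g k < \<eta>"
    using order_tendstoD(2)[OF g, of \<eta>] by (auto simp: eventually_sequentially)
  have bnd: "s (K + j) \<le> q ^ j * s K + \<epsilon> / 2" for j
  proof (induction j)
    case (Suc j)
    have "s (K + Suc j) \<le> q * s (K + j) + \<eta>"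
      using rec[of "K + j"] K[of "K + j"] by simp
    also have "\<dots> \<le> q * (q ^ j * s K + \<epsilon> / 2) + \<eta>"
      using Suc q by (simp add: mult_left_mono)
    also have "\<dots> = q ^ Suc j * s K + \<epsilon> / 2" by (simp add: \<eta>_def field_simps)
    finally show ?case .
  qed (use e in simp)
  have "(\<lambda>j. q ^ j * s K) \<longlonglongrightarrow> 0"
    using LIMSEQ_power_zero[of q] q tendsto_mult_left_zero by auto
  then obtain J where J: "\<And>j. j \<ge> J \<Longrightarrow> q ^ j * s K < \<epsilon> / 2"
    using order_tendstoD(2)[of "\<lambda>j. q ^ j * s K" 0 sequentially "\<epsilon> / 2"] e
    unfolding eventually_sequentially by (metis half_gt_zero)
  show "\<exists>N. \<forall>k\<ge>N. norm (s k - 0) < \<epsilon>"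
  proof (intro exI allI impI)
    fix k assume "k \<ge> K + J"
    then obtain j where "k = K + j" "j \<ge> J" by (metis le_iff_add add.assoc)
    then show "norm (s k - 0) < \<epsilon>" using bnd[of j] J[of j] nn by simp
  qed
qed

section \<open>Polynomials in a matrix and orbits with vanishing forcing\<close>

definition poly_matrix :: "complex poly \<Rightarrow> complex^'m^'m \<Rightarrow> complex^'m \<Rightarrow> complex^'m" where
  "poly_matrix p M x = (\<Sum>i\<le>degree p. coeff p i *s ((*v) M ^^ i) x)"

lemma poly_matrix_eq:
  assumes "degree p \<le> N"
  shows "poly_matrix p M x = (\<Sum>i\<le>N. coeff p i *s ((*v) M ^^ i) x)"
  unfolding poly_matrix_def
  by (rule sum.mono_neutral_left) (use assms in \<open>auto simp: coeff_eq_0\<close>)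

lemma mat_vec_iter_add: "((*v) (M::complex^'m^'m) ^^ i) (x + y) = ((*v) M ^^ i) x + ((*v) M ^^ i) y"
  by (induction i) (simp_all add: matrix_vector_right_distrib)

lemma mat_vec_iter_scale: "((*v) (M::complex^'m^'m) ^^ i) (c *s x) = c *s ((*v) M ^^ i) x"
  by (induction i) (simp_all add: vector_scalar_commute)

lemma mat_vec_iter_comm: "((*v) (M::complex^'m^'m) ^^ i) (M *v x) = M *v (((*v) M ^^ i) x)"
  by (metis funpow_swap1)

lemma poly_matrix_add: "poly_matrix p M (x + y) = poly_matrix p M x + poly_matrix p M y"
  by (simp add: poly_matrix_def mat_vec_iter_add vec.scale_right_distrib sum.distrib)

lemma poly_matrix_scale: "poly_matrix p M (c *s x) = c *s poly_matrix p M x"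
  by (simp add: poly_matrix_def mat_vec_iter_scale vec.scale_sum_right mult.commute)

lemma poly_matrix_comm: "poly_matrix p M (M *v x) = M *v poly_matrix p M x"
  by (simp add: poly_matrix_def mat_vec_iter_comm vec.linear_sum[OF matrix_vector_mul_linear_gen]
      vector_scalar_commute o_def)

text \<open>Multiplying \<open>q\<close> by \<open>X - z\<close> adds its shifted coefficients to
  \<open>- z\<close> times its coefficients, and the shift is one more application of
  \<open>M\<close>. This splits off a root in the induction on the degree.\<close>

lemma poly_matrix_linear_factor:
  "poly_matrix ([:- z, 1:] * q) M x = poly_matrix q M (M *v x - z *s x)"
proof -
  let ?N = "Suc (degree q)"
  have 1: "degree ([:- z, 1:] * q) \<le> ?N"
    using degree_mult_le[of "[:- z, 1:]" q] by simp
  have 2: "poly_matrix q M (M *v x) = (\<Sum>i\<le>?N. coeff (pCons 0 q) i *s ((*v) M ^^ i) x)"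
    by (simp add: sum.atMost_Suc_shift funpow_swap1 poly_matrix_def del: sum.atMost_Suc)
  have 3: "poly_matrix q M (- z *s x) = (\<Sum>i\<le>?N. coeff (smult (- z) q) i *s ((*v) M ^^ i) x)"
    unfolding poly_matrix_scale by (subst poly_matrix_eq[of q ?N])
      (simp_all only: vec.scale_sum_right vec.scale_scale coeff_smult le_SucI order.refl)
  have "poly_matrix q M (M *v x - z *s x) = poly_matrix q M (M *v x) + poly_matrix q M (- z *s x)"
    by (metis poly_matrix_add diff_conv_add_uminus vec.scale_minus_left)
  also have "\<dots> = poly_matrix ([:- z, 1:] * q) M x"
    unfolding 2 3 poly_matrix_eq[OF 1] 
    by (simp only: flip: sum.distrib vec.scale_left_distrib coeff_add) (simp add: add.commute)
  finally show ?thesis by simp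
qed

text \<open>
  Induction on an annihilating polynomial \<open>p = (X - z) q\<close>: if \<open>z\<close> is an eigenvalue,
  the sequence \<open>(M - z) y\<close> falls under the induction hypothesis for \<open>q\<close>, and
  \<open>y\<close> then obeys a scalar contraction with factor \<open>z\<close>; otherwise \<open>M - z\<close> is injective and
  the factor can be dropped. No Jordan form or adapted norm is needed.
\<close>

lemma perturbed_orbit_tendsto_0_poly:
  fixes M :: "complex^'m^'m"
  assumes ev: "\<And>z v. v \<noteq> 0 \<Longrightarrow> M *v v = z *s v \<Longrightarrow> cmod z < 1"
    and "p \<noteq> 0" "(\<lambda>k. y (Suc k) - M *v y k) \<longlonglongrightarrow> 0" "(\<lambda>k. poly_matrix p M (y k)) \<longlonglongrightarrow> 0"
  shows "y \<longlonglongrightarrow> 0"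
  using assms(2-)
proof (induction "degree p" arbitrary: p y)
  case 0
  then obtain c where c: "p = [:c:]" "c \<noteq> 0" by (metis degree_eq_zeroE pCons_0_0)
  then have "(\<lambda>k. norm (c *s y k)) \<longlonglongrightarrow> 0" using 0(4) by (simp add: poly_matrix_def tendsto_norm_zero)
  moreover have "norm (c *s y k) = cmod c * norm (y k)" for k
    by (simp add: norm_vec_def norm_mult L2_set_right_distrib)
  ultimately have "(\<lambda>k. norm (y k)) \<longlonglongrightarrow> 0"
    using c tendsto_mult_left_iff[of "cmod c" "\<lambda>k. norm (y k)" 0] by simp
  then show ?case by (rule tendsto_norm_zero_cancel)
next
  case (Suc n)
  then obtain z where "poly p z = 0"
    by (metis fundamental_theorem_of_algebra constant_degree nat.distinct(1))
  then obtain q where q: "p = [:- z, 1:] * q" by (metis dvdE poly_eq_0_iff_dvd)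
  have q0: "q \<noteq> 0" using q Suc.prems(1) by auto
  have "degree p = Suc (degree q)"
    unfolding q using q0 by (subst degree_mult_eq) simp_all
  then have dq: "n = degree q" using Suc.hyps(2) by simp
  define D where "D x = M *v x - z *s x" for x
  have lin: "linear D"
    unfolding D_def
    by (rule linearI)
      (simp_all add: algebra_simps vec_eq_iff matrix_vector_mult_def scaleR_sum_right sum.distrib)
  have dcont: "(\<lambda>k. D (u k)) \<longlonglongrightarrow> 0" if "u \<longlonglongrightarrow> 0" for u :: "nat \<Rightarrow> _"
    using linear_conv_bounded_linear[of D] lin that bounded_linear.tendsto_zero by blast
  show ?case
  proof (cases "inj D")
    case True
    \<comment> \<open>In finite dimension an injective \<open>D\<close> is bounded below, so decay
      of \<open>D (poly_matrix q M (y k))\<close> passes to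
      \<open>poly_matrix q M (y k)\<close>.\<close>
    then obtain B where B: "B > 0" "\<And>x. B * norm x \<le> norm (D x)"
      using linear_inj_bounded_below_pos[OF lin] by metis
    have "(\<lambda>k. D (poly_matrix q M (y k))) \<longlonglongrightarrow> 0"
    proof -
      have "D (poly_matrix q M x) = poly_matrix p M x" for x
        using poly_matrix_add[of q M "M *v x - z *s x" "z *s x"]
        unfolding q poly_matrix_linear_factor
        by (simp add: D_def poly_matrix_comm poly_matrix_scale)
      then show ?thesis using Suc by simp
    qed
    then have "(\<lambda>k. norm (D (poly_matrix q M (y k))) / B) \<longlonglongrightarrow> 0"
      by (intro tendsto_divide_zero tendsto_norm_zero)
    then have "(\<lambda>k. poly_matrix q M (y k)) \<longlonglongrightarrow> 0"
      by (rule Lim_null_comparison[rotated]) (use B in \<open>auto simp: field_simps\<close>)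
    then show ?thesis using Suc.hyps(1)[OF dq q0 Suc.prems(2)] by blast
  next
    case False
    then obtain v where "v \<noteq> 0" "D v = 0" using lin linear_injective_0 by blast
    then have z: "cmod z < 1" using ev by (simp add: D_def)
    have "(\<lambda>k. D (y (Suc k) - M *v y k)) \<longlonglongrightarrow> 0" using dcont Suc.prems(2) by blast
    \<comment> \<open>\<open>D\<close> commutes with \<open>M\<close>, so \<open>D (y k)\<close> is
      again an orbit with vanishing forcing.\<close>
    moreover have "D (y (Suc k) - M *v y k) = D (y (Suc k)) - M *v D (y k)" for k
      by (simp add: D_def matrix_vector_mult_diff_distrib vector_scalar_commute vec.scale_right_diff_distrib)
    ultimately have 1: "(\<lambda>k. D (y (Suc k)) - M *v D (y k)) \<longlonglongrightarrow> 0" by simp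
    have 2: "(\<lambda>k. poly_matrix q M (D (y k))) \<longlonglongrightarrow> 0"
      using Suc.prems(3) unfolding q poly_matrix_linear_factor D_def .
    have "(\<lambda>k. D (y k)) \<longlonglongrightarrow> 0" using Suc.hyps(1)[OF dq q0 1 2] .
    then have w: "(\<lambda>k. norm ((y (Suc k) - M *v y k) + D (y k))) \<longlonglongrightarrow> 0"
      using Suc.prems(2) by (intro tendsto_norm_zero tendsto_add_zero)
    have "(\<lambda>k. norm (y k)) \<longlonglongrightarrow> 0"
    proof (rule contractive_recurrence_tendsto_0[OF _ _ z _ w])
      fix k
      have "y (Suc k) = z *s y k + ((y (Suc k) - M *v y k) + D (y k))" by (simp add: D_def)
      moreover have "norm (z *s y k) = cmod z * norm (y k)"
        by (simp add: norm_vec_def norm_mult L2_set_right_distrib)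
      ultimately show "norm (y (Suc k)) \<le> cmod z * norm (y k) + norm ((y (Suc k) - M *v y k) + D (y k))"
        by (metis norm_triangle_ineq)
    qed simp_all
    then show ?thesis by (rule tendsto_norm_zero_cancel)
  qed
qed

text \<open>The powers of \<open>M\<close> up to the exponent \<open>N\<close> outnumber the real
  dimension \<open>N\<close> of the matrix space, so they satisfy a nontrivial linear relation; its
  coefficients are those of \<open>p\<close>.\<close>

lemma annihilating_polynomial:
  fixes M :: "complex^'m^'m"
  shows "\<exists>p. p \<noteq> 0 \<and> (\<forall>x. poly_matrix p M x = 0)"
proof -
  define P where "P i = ((**) M ^^ i) (mat 1)" for i
  have P: "P i *v x = ((*v) M ^^ i) x" for i x
    by (induction i) (simp_all add: P_def flip: matrix_vector_mul_assoc)
  define N where "N = DIM(complex^'m^'m)"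
  have "\<exists>c :: nat \<Rightarrow> real. (\<exists>i\<le>N. c i \<noteq> 0) \<and> (\<Sum>i\<le>N. c i *\<^sub>R P i) = 0"
  \<comment> \<open>\<open>dependent\<close> speaks of a set, so a repeated power is treated apart:
    it gives the relation \<open>P i - P j = 0\<close>.\<close>
  proof (cases "inj_on P {..N}")
    case True
    then have "dependent (P ` {..N})"
      by (intro dependent_biggerset) (simp add: card_image N_def)
    then obtain u where u: "\<exists>v\<in>P ` {..N}. u v \<noteq> 0" "(\<Sum>v\<in>P ` {..N}. u v *\<^sub>R v) = 0"
      using dependent_finite[of "P ` {..N}"] by auto
    then have "(\<Sum>i\<le>N. u (P i) *\<^sub>R P i) = 0" using True by (simp add: sum.reindex)
    then show ?thesis using u(1) by (intro exI[of _ "\<lambda>i. u (P i)"]) auto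
  next
    case False
    then obtain i j where ij: "i \<le> N" "j \<le> N" "i \<noteq> j" "P i = P j" by (auto simp: inj_on_def)
    have "(\<Sum>k\<le>N. (of_bool (k = i) - of_bool (k = j)) *\<^sub>R P k) = P i - P j"
      using ij by (simp add: scaleR_left_diff_distrib sum_subtractf of_bool_def
        if_distrib[of "\<lambda>x. x *\<^sub>R _"] cong: if_cong)
    then show ?thesis using ij by (intro exI[of _ "\<lambda>k. of_bool (k = i) - of_bool (k = j)"]) auto
  qed
  then obtain c :: "nat \<Rightarrow> real" and i0 where c: "i0 \<le> N" "c i0 \<noteq> 0" "(\<Sum>i\<le>N. c i *\<^sub>R P i) = 0" by blast
  define p where "p = (\<Sum>i\<le>N. monom (complex_of_real (c i)) i)"
  have cf: "coeff p i = (if i \<le> N then complex_of_real (c i) else 0)" for i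
    by (simp add: p_def coeff_sum)
  have scal: "complex_of_real r *s v = r *\<^sub>R v" for r and v :: "complex^'m"
    by (simp add: vec_eq_iff) (simp add: scaleR_conv_of_real)
  have smv: "(r *\<^sub>R B) *v x = r *\<^sub>R (B *v x)" for r x and B :: "complex^'m^'m"
    by (simp add: vec_eq_iff matrix_vector_mult_def scaleR_sum_right)
  have "degree p \<le> N" by (rule degree_le) (simp add: cf)
  have "poly_matrix p M x = 0" for x
  proof -
    have "poly_matrix p M x = (\<Sum>i\<le>N. (c i *\<^sub>R P i) *v x)"
      unfolding poly_matrix_eq[OF \<open>degree p \<le> N\<close>]
      by (intro sum.cong) (simp_all add: cf scal smv P)
    also have "\<dots> = (\<Sum>i\<le>N. c i *\<^sub>R P i) *v x"
      by (induction N) (simp_all add: matrix_vector_mult_add_rdistrib)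
    finally show ?thesis using c by simp
  qed
  moreover have "p \<noteq> 0" using c cf[of i0] by auto
  ultimately show ?thesis by blast
qed

text \<open>The embedding \<open>C\<close> into complex vectors is isometric and intertwines
  \<open>A\<close> with its complexification, where the eigenvalues live. An annihilating polynomial
  starts the induction with a zero sequence.\<close>

lemma perturbed_orbit_tendsto_0:
  fixes A :: "real^'m^'m"
  assumes ev: "\<And>z. complex_eigenvalue A z \<Longrightarrow> cmod z < 1"
    and u: "(\<lambda>k. y (Suc k) - A *v y k) \<longlonglongrightarrow> 0"
  shows "y \<longlonglongrightarrow> 0"
proof -
  let ?M = "map_matrix complex_of_real A"
  define C :: "real^'m \<Rightarrow> complex^'m" where "C x = (\<chi> i. complex_of_real (x $ i))" for x
  have nC: "norm (C x) = norm x" for x by (simp add: C_def norm_vec_def)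
  have eq: "norm (C (y (Suc k)) - ?M *v C (y k)) = norm (y (Suc k) - A *v y k)" for k
  proof -
    have "C (y (Suc k)) - ?M *v C (y k) = C (y (Suc k) - A *v y k)"
      by (simp add: C_def vec_eq_iff matrix_vector_mult_def map_matrix_def)
    then show ?thesis by (simp only: nC)
  qed
  have "(\<lambda>k. C (y (Suc k)) - ?M *v C (y k)) \<longlonglongrightarrow> 0"
    by (rule tendsto_norm_zero_cancel) (unfold eq, rule tendsto_norm_zero[OF u])
  moreover obtain p where "p \<noteq> 0" "\<And>x. poly_matrix p ?M x = 0"
    using annihilating_polynomial by metis
  ultimately have "(\<lambda>k. C (y k)) \<longlonglongrightarrow> 0"
    using ev unfolding complex_eigenvalue_def
    by (intro perturbed_orbit_tendsto_0_poly[of ?M p "\<lambda>k. C (y k)"]) auto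
  then have "(\<lambda>k. norm (y k)) \<longlonglongrightarrow> 0" unfolding nC[symmetric] by (rule tendsto_norm_zero)
  then show ?thesis by (rule tendsto_norm_zero_cancel)
qed

section \<open>Stability of a cycle from its linear parts\<close>

text \<open>The product of the \<open>k\<close> linear parts met from phase \<open>i\<close> on,
  \<open>L i\<close> being applied first.\<close>

primrec linearized_iterate :: "(nat \<Rightarrow> 'p \<Rightarrow> 'p) \<Rightarrow> nat \<Rightarrow> nat \<Rightarrow> 'p \<Rightarrow> 'p" where
  "linearized_iterate L i 0 v = v"
| "linearized_iterate L i (Suc k) v = L (i + k) (linearized_iterate L i k v)"

lemma linear_linearized_iterate:
  fixes L :: "nat \<Rightarrow> 'p::real_vector \<Rightarrow> 'p"
  assumes "\<And>k. linear (L k)"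
  shows "linear (linearized_iterate L i k)"
proof (induction k)
  case (Suc k)
  have "linearized_iterate L i (Suc k) = L (i + k) \<circ> linearized_iterate L i k" by (simp add: fun_eq_iff)
  then show ?case using linear_compose[OF Suc assms] by (simp add: o_def)
qed (simp add: linear_iff)

text \<open>Uniform boundedness in finite dimension: the bounds at the basis vectors add up to a
  bound for all vectors.\<close>

lemma pointwise_bounded_linear_uniform:
  fixes F :: "nat \<Rightarrow> 'p::euclidean_space \<Rightarrow> 'q::real_normed_vector"
  assumes lin: "\<And>k. linear (F k)" and bd: "\<And>v. Bseq (\<lambda>k. F k v)"
  obtains C where "C > 0" "\<And>k v. norm (F k v) \<le> C * norm v"
proof -
  obtain B where B: "\<And>v k. norm (F k v) \<le> B v"
    using bd unfolding Bseq_def by metis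
  have B0: "B v \<ge> 0" for v using B[of 0 v] norm_ge_zero order_trans by blast
  define C where "C = (\<Sum>e\<in>Basis. B e) + 1"
  show ?thesis
  proof
    show "C > 0" unfolding C_def by (intro add_nonneg_pos sum_nonneg B0) simp
  next
    fix k v
    have "F k v = F k (\<Sum>e\<in>Basis. (v \<bullet> e) *\<^sub>R e)" by (simp add: euclidean_representation)
    also have "\<dots> = (\<Sum>e\<in>Basis. (v \<bullet> e) *\<^sub>R F k e)"
      by (simp add: linear_sum[OF lin] linear_cmul[OF lin])
    also have "norm \<dots> \<le> (\<Sum>e\<in>Basis. B e * norm v)"
    proof (rule sum_norm_le)
      fix e :: 'p assume "e \<in> Basis"
      then show "norm ((v \<bullet> e) *\<^sub>R F k e) \<le> B e * norm v"
        using mult_mono[OF Basis_le_norm[of e v] B[of k e]] by (simp add: mult.commute)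
    qed
    also have "\<dots> \<le> C * norm v" by (simp add: C_def sum_distrib_right distrib_right)
    finally show "norm (F k v) \<le> C * norm v" .
  qed
qed

text \<open>Within distance \<open>r\<close> of the cycle, deviations evolve by the linear parts.
  Their products are uniformly bounded, so a small deviation never reaches \<open>r\<close> and the
  linear description holds for all time; decay of the products then gives attraction.\<close>

lemma asymptotically_stable_cycle:
  fixes T :: "'p::euclidean_space \<Rightarrow> 'p" and W :: "nat \<Rightarrow> 'p"
  assumes n: "n > 0" and orbit: "\<And>k. W (Suc k) = T (W k)"
    and rng: "range W = W ` {..<n}"
    and lin: "\<And>k. linear (L k)" and r: "r > 0"
    and loc: "\<And>k p. dist p (W k) < r \<Longrightarrow> T p - T (W k) = L k (p - W k)"
    and conv: "\<And>i v. (\<lambda>k. linearized_iterate L i k v) \<longlonglongrightarrow> 0"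
  shows "asymptotically_stable T (range W)"
proof -
  let ?S = "range W"
  have fin: "finite ?S" unfolding rng by simp
  have "\<exists>C>0. \<forall>k v. norm (linearized_iterate L i k v) \<le> C * norm v" for i
  proof -
    have "Bseq (\<lambda>k. linearized_iterate L i k v)" for v
      using conv convergentI convergent_imp_Bseq by blast
    then obtain C where "C > 0" "\<And>k v. norm (linearized_iterate L i k v) \<le> C * norm v"
      by (rule pointwise_bounded_linear_uniform[OF linear_linearized_iterate[of L, OF lin]]) blast
    then show ?thesis by blast
  qed
  then obtain c where c: "\<And>i. c i > 0" "\<And>i k v. norm (linearized_iterate L i k v) \<le> c i * norm v"
    by metis
  \<comment> \<open>Each starting phase has its own bound. By \<open>rng\<close> the phases below
    \<open>n\<close> reach every point of the cycle, so a finite maximum suffices.\<close>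
  define C where "C = Max (c ` {..<n})"
  have cC: "c i \<le> C" if "i < n" for i unfolding C_def using that by (intro Max_ge) auto
  have C0: "C > 0" using cC[OF n] c(1)[of 0] by linarith
  have track: "(T ^^ k) p - W (i + k) = linearized_iterate L i k (p - W i)"
    if i: "i < n" and d: "C * dist p (W i) < r" for i p k
  proof (induction k)
    case (Suc k)
    have "dist ((T ^^ k) p) (W (i + k)) \<le> c i * dist p (W i)"
      unfolding dist_norm Suc by (rule c)
    also have "\<dots> \<le> C * dist p (W i)" using cC[OF i] by (simp add: mult_right_mono)
    finally show ?case using loc[of "(T ^^ k) p" "i + k"] d Suc orbit by simp
  qed simp
  have near: "\<exists>i<n. dist p (W i) < \<delta>" if "infdist p ?S < \<delta>" for p \<delta>
  proof -
    obtain z where "z \<in> ?S" "infdist p ?S = dist p z"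
      using infdist_attains_inf[of ?S p] fin finite_imp_closed by blast
    then show ?thesis using that unfolding rng by auto
  qed
  have "lyapunov_stable T ?S"
    unfolding lyapunov_stable_def
  proof (intro allI impI)
    fix \<epsilon> :: real assume e: "\<epsilon> > 0"
    \<comment> \<open>The bound \<open>r\<close> keeps the orbit where \<open>track\<close> applies;
      \<open>\<epsilon>\<close> is the required closeness.\<close>
    define \<delta> where "\<delta> = min r \<epsilon> / C"
    have d0: "\<delta> > 0" using r e C0 by (simp add: \<delta>_def)
    show "\<exists>\<delta>>0. \<forall>p. infdist p ?S < \<delta> \<longrightarrow> (\<forall>k. infdist ((T ^^ k) p) ?S < \<epsilon>)"
    proof (intro exI conjI allI impI)
      fix p k assume "infdist p ?S < \<delta>"
      then obtain i where i: "i < n" "dist p (W i) < \<delta>" using near by blast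
      then have d: "C * dist p (W i) < min r \<epsilon>" using C0 by (simp add: \<delta>_def field_simps)
      have "infdist ((T ^^ k) p) ?S \<le> dist ((T ^^ k) p) (W (i + k))" by (rule infdist_le) simp
      also have "\<dots> = norm (linearized_iterate L i k (p - W i))"
        using track[OF i(1)] d by (simp add: dist_norm)
      also have "\<dots> \<le> c i * dist p (W i)" unfolding dist_norm by (rule c)
      also have "\<dots> \<le> C * dist p (W i)" using cC[OF i(1)] by (simp add: mult_right_mono)
      finally show "infdist ((T ^^ k) p) ?S < \<epsilon>" using d by simp
    qed (rule d0)
  qed
  moreover have "locally_attractive T ?S"
    unfolding locally_attractive_def
  proof (intro exI conjI allI impI)
    show "r / C > 0" using r C0 by simp
    fix p assume "infdist p ?S < r / C"
    then obtain i where i: "i < n" "dist p (W i) < r / C" using near by blast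
    then have d: "C * dist p (W i) < r" using C0 by (simp add: field_simps)
    show "(\<lambda>k. infdist ((T ^^ k) p) ?S) \<longlonglongrightarrow> 0"
    proof (rule Lim_null_comparison[OF _ tendsto_norm_zero[OF conv[of i "p - W i"]]], intro always_eventually allI)
      fix k
      have "infdist ((T ^^ k) p) ?S \<le> dist ((T ^^ k) p) (W (i + k))" by (rule infdist_le) simp
      then show "norm (infdist ((T ^^ k) p) ?S) \<le> norm (linearized_iterate L i k (p - W i))"
        using track[OF i(1) d] by (simp add: dist_norm infdist_nonneg)
    qed
  qed
  ultimately show ?thesis by (simp add: asymptotically_stable_def)
qed

section \<open>Stability of the cycle with one right and \<open>n - 1\<close> left points\<close>

text \<open>Divide \<open>k\<close> by \<open>n\<close>: the quotient yields a power of
  \<open>q\<close>, the remainder a value from the first period.\<close>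

lemma periodic_mult_tendsto_0:
  fixes \<xi> :: "nat \<Rightarrow> real"
  assumes n: "n > 0" and per: "\<And>k. \<xi> (k + n) = q * \<xi> k" and q: "\<bar>q\<bar> < 1"
  shows "\<xi> \<longlonglongrightarrow> 0"
proof -
  have pw: "\<xi> (j + k * n) = q ^ k * \<xi> j" for j k
    by (induction k) (simp_all add: per[symmetric] algebra_simps flip: per, metis add.assoc add.commute per)
  define C where "C = (\<Sum>j<n. \<bar>\<xi> j\<bar>)"
  have "\<bar>\<xi> k\<bar> \<le> \<bar>q\<bar> ^ (k div n) * C" for k
  proof -
    have "\<xi> k = q ^ (k div n) * \<xi> (k mod n)" using pw[of "k mod n" "k div n"] by simp
    moreover have "\<bar>\<xi> (k mod n)\<bar> \<le> C"
      unfolding C_def by (rule member_le_sum) (use n in auto)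
    ultimately show ?thesis by (simp add: abs_mult power_abs mult_left_mono)
  qed
  moreover have "(\<lambda>k. \<bar>q\<bar> ^ (k div n) * C) \<longlonglongrightarrow> 0"
  proof (rule tendsto_mult_left_zero, rule filterlim_compose[of "\<lambda>k. \<bar>q\<bar> ^ k"])
    show "(\<lambda>k. \<bar>q\<bar> ^ k) \<longlonglongrightarrow> 0" using q by (intro LIMSEQ_power_zero) simp
    show "filterlim (\<lambda>k. k div n) sequentially sequentially"
      unfolding filterlim_at_top eventually_sequentially
      using n by (metis div_le_mono nonzero_mult_div_cancel_right not_gr_zero)
  qed
  ultimately show ?thesis by (intro Lim_null_comparison[of \<xi>]) (auto intro!: always_eventually)
qed

text \<open>No point of the cycle has first coordinate 0, so a single branch governs a neighbourhood
  of each, and the criterion for linear parts applies.\<close>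

lemma RL_cycle_asymptotically_stable:
  fixes a d \<mu> :: real and A :: "real^'m^'m" and b e h :: "real^'m"
  assumes n: "n > 0" and ev: "\<And>z. complex_eigenvalue A z \<Longrightarrow> cmod z < 1"
    and q: "\<bar>a ^ (n - 1) * d\<bar> < 1"
    and Z: "RL_cycle (pl_map a d \<mu> A b e h) n Z"
  shows "asymptotically_stable (pl_map a d \<mu> A b e h) (Z ` {1..n})"
proof -
  let ?T = "pl_map a d \<mu> A b e h"
  \<comment> \<open>Phases count from 0. Phase 0 is \<open>Z 1\<close>, the only right point, so
    \<open>d\<close> and \<open>e\<close> belong to \<open>k mod n = 0\<close>.\<close>
  define W where "W k = Z (k mod n + 1)" for k
  define s where "s k = (if k mod n = 0 then d else a)" for k
  define c where "c k = (if k mod n = 0 then e else b)" for k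
  define L where "L k v = (s k * fst v, fst v *\<^sub>R c k + A *v snd v)" for k and v :: "real \<times> (real^'m)"
  have md: "k mod n < n" for k using n by simp
  have W_less: "W k = Z (Suc k)" if "k < n" for k using that by (simp add: W_def)
  have "W ` {..<n} = Z ` Suc ` {..<n}"
    unfolding image_image by (intro image_cong refl) (simp add: W_less)
  then have img: "W ` {..<n} = Z ` {1..n}" by (simp add: image_Suc_lessThan)
  have "W k = W (k mod n)" for k by (simp add: W_def)
  then have rng: "range W = W ` {..<n}" using md by (auto simp: image_iff) (metis lessThan_iff)
  have pos: "fst (W k) > 0" if "k mod n = 0" for k using Z that by (simp add: W_def RL_cycle_def)
  have neg: "fst (W k) < 0" if "k mod n \<noteq> 0" for k
  proof -
    have "k mod n + 1 \<in> {2..n}" using that md[of k] by auto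
    then show ?thesis using Z unfolding W_def RL_cycle_def by blast
  qed
  \<comment> \<open>The distance from the cycle to the switching hyperplane: closer points use the
    same branch.\<close>
  define r where "r = Min ((\<lambda>k. \<bar>fst (W k)\<bar>) ` {..<n})"
  have r_le: "r \<le> \<bar>fst (W k)\<bar>" for k
  proof -
    have "r \<le> \<bar>fst (W (k mod n))\<bar>" unfolding r_def using md by (intro Min_le) auto
    then show ?thesis by (simp add: W_def)
  qed
  have r0: "r > 0"
  proof -
    have "r \<in> (\<lambda>k. \<bar>fst (W k)\<bar>) ` {..<n}" unfolding r_def using n by (intro Min_in) auto
    then show ?thesis using pos neg by (metis (mono_tags, lifting) image_iff zero_less_abs_iff less_irrefl)
  qed
  have "asymptotically_stable ?T (range W)"
  proof (rule asymptotically_stable_cycle[OF n _ rng _ r0, where L = L])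
    fix k
    show "W (Suc k) = ?T (W k)"
    proof (cases "Suc (k mod n) = n")
      case True
      then show ?thesis using Z by (simp add: W_def mod_Suc RL_cycle_def)
    next
      case False
      then have "k mod n + 1 \<in> {1..<n}" using md[of k] by auto
      then have "?T (Z (k mod n + 1)) = Z (k mod n + 1 + 1)" using Z unfolding RL_cycle_def by blast
      then show ?thesis using False by (simp add: W_def mod_Suc)
    qed
    show "linear (L k)"
      by (rule linearI) (simp_all add: L_def algebra_simps matrix_vector_right_distrib matrix_vector_mult_scaleR)
  next
    fix k p assume "dist p (W k) < r"
    then have "\<bar>fst p - fst (W k)\<bar> < \<bar>fst (W k)\<bar>"
      using dist_fst_le[of p "W k"] r_le[of k] by (simp add: dist_real_def)
    then show "?T p - ?T (W k) = L k (p - W k)"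
      using pos[of k] neg[of k]
      by (cases p; cases "W k"; cases "k mod n = 0")
        (auto simp: L_def pl_map_def pl_f_def pl_G_def s_def c_def algebra_simps matrix_vector_mult_diff_distrib)
  next
    fix i v
    let ?v = "\<lambda>k. linearized_iterate L i k v"
    \<comment> \<open>A window of \<open>n\<close> indices meets phase 0 exactly once: sliding it by
      one trades \<open>s k\<close> for the equal \<open>s (k + n)\<close>.\<close>
    have prd: "(\<Prod>j\<in>{k..<k + n}. s j) = a ^ (n - 1) * d" for k
    proof (induction k)
      case 0
      have "(\<Prod>j\<in>{0..<n}. s j) = s 0 * (\<Prod>j\<in>{1..<n}. s j)"
        using n by (simp add: prod.atLeast_Suc_lessThan)
      also have "(\<Prod>j\<in>{1..<n}. s j) = (\<Prod>j\<in>{1..<n}. a)"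
        by (intro prod.cong) (auto simp: s_def)
      finally show ?case by (simp add: s_def)
    next
      case (Suc k)
      have "(\<Prod>j\<in>{Suc k..<Suc k + n}. s j) = (\<Prod>j\<in>{Suc k..<k + n}. s j) * s (k + n)"
        using n by (simp add: prod.atLeastLessThan_Suc)
      also have "s (k + n) = s k" by (simp add: s_def)
      also have "(\<Prod>j\<in>{Suc k..<k + n}. s j) * s k = (\<Prod>j\<in>{k..<k + n}. s j)"
        using n by (simp add: prod.atLeast_Suc_lessThan)
      finally show ?case using Suc by simp
    qed
    have "fst (?v (k + m)) = (\<Prod>j\<in>{i + k..<i + k + m}. s j) * fst (?v k)" for k m
      by (induction m) (simp_all add: L_def prod.atLeastLessThan_Suc add.assoc)
    then have "fst (?v (k + n)) = a ^ (n - 1) * d * fst (?v k)" for k by (simp only: prd)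
    then have \<xi>: "(\<lambda>k. fst (?v k)) \<longlonglongrightarrow> 0"
      by (intro periodic_mult_tendsto_0[OF n _ q])
    \<comment> \<open>The forcing of the second coordinate is
      \<open>fst (?v k) *\<^sub>R c (i + k)\<close>, with \<open>c\<close> bounded.\<close>
    have "(\<lambda>k. snd (?v (Suc k)) - A *v snd (?v k)) \<longlonglongrightarrow> 0"
    proof (rule Lim_null_comparison[OF _ tendsto_mult_left_zero[OF tendsto_norm_zero[OF \<xi>], of "norm e + norm b"]],
        intro always_eventually allI)
      fix k
      have "norm (c (i + k)) \<le> norm e + norm b" by (simp add: c_def)
      then show "norm (snd (?v (Suc k)) - A *v snd (?v k)) \<le> norm (fst (?v k)) * (norm e + norm b)"
        by (simp add: L_def mult_left_mono)
    qed
    then have "(\<lambda>k. snd (?v k)) \<longlonglongrightarrow> 0"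
      by (rule perturbed_orbit_tendsto_0[rotated]) (rule ev)
    then show "?v \<longlonglongrightarrow> 0"
      using tendsto_Pair[OF \<xi>, of "\<lambda>k. snd (?v k)" 0] by (simp add: zero_prod_def)
  qed
  then show ?thesis by (simp only: rng img)
qed

section \<open>Existence of the cycle\<close>

text \<open>The orbit of \<open>y\<close> under \<open>A\<close> tends to zero, yet returns to
  \<open>y\<close> every \<open>n\<close> steps. In other words, \<open>I - A^n\<close> is
  injective.\<close>

lemma iterate_fixed_point_eq_0:
  fixes A :: "real^'m^'m"
  assumes "n > 0" and ev: "\<And>z. complex_eigenvalue A z \<Longrightarrow> cmod z < 1"
    and y: "((*v) A ^^ n) y = y"
  shows "y = 0"
proof -
  have "(\<lambda>k. ((*v) A ^^ k) y) \<longlonglongrightarrow> 0"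
    by (rule perturbed_orbit_tendsto_0[of A]) (simp_all add: ev)
  then have "(\<lambda>k. ((*v) A ^^ (n * k)) y) \<longlonglongrightarrow> 0"
    using LIMSEQ_subseq_LIMSEQ[of "\<lambda>k. ((*v) A ^^ k) y" 0 "\<lambda>k. n * k"] assms(1)
    by (simp add: strict_mono_def o_def)
  moreover have "((*v) A ^^ (n * k)) y = y" for k
    unfolding funpow_mult[symmetric] by (induction k) (simp_all add: y)
  ultimately show ?thesis by (simp add: LIMSEQ_const_iff)
qed

text \<open>By superposition, a solution is a free orbit from some \<open>y\<close> plus the
  solution \<open>w\<close> from 0. Closing up after \<open>n\<close> steps means
  \<open>(I - A^n) y = w n\<close>, and an injective linear map in finite dimension is
  surjective.\<close>

lemma affine_recurrence_periodic_point:
  fixes A :: "real^'m^'m"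
  assumes "n > 0" and ev: "\<And>z. complex_eigenvalue A z \<Longrightarrow> cmod z < 1"
  obtains y where "\<And>k. y (Suc k) = A *v y k + u k" "y n = y 0"
proof -
  define w where "w = rec_nat 0 (\<lambda>k x. A *v x + u k)"
  have w: "w 0 = 0" "\<And>k. w (Suc k) = A *v w k + u k" by (simp_all add: w_def)
  let ?f = "\<lambda>y. y - ((*v) A ^^ n) y"
  have "linear ((*v) A ^^ n)" 
  proof (induction n)
    case (Suc n)
    then show ?case using linear_compose[OF Suc matrix_vector_mul_linear[of A]] by (simp add: o_def)
  qed (simp add: linear_iff)
  then have lin: "linear ?f" by (intro linear_compose_sub linear_ident)
  moreover have "inj ?f" unfolding linear_injective_0[OF lin]
    using iterate_fixed_point_eq_0[of n A] assms(1) ev by auto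
  ultimately obtain y where "?f y = w n" using linear_injective_imp_surjective by (metis surjD)
  then have y: "((*v) A ^^ n) y + w n = y" by (simp add: algebra_simps)
  show ?thesis
    by (rule that[of "\<lambda>k. ((*v) A ^^ k) y + w k"]) (simp_all add: w y matrix_vector_right_distrib)
qed

text \<open>The first coordinate evolves on its own and alone selects the branch, so the scalar
  cycle is found first; its values then force the recurrence for \<open>Y\<close>.\<close>

lemma RL_cycle_exists:
  fixes a d \<mu> :: real and A :: "real^'m^'m" and b e h :: "real^'m"
  assumes n: "n \<ge> 2" and \<mu>: "\<mu> > 0" and ev: "\<And>z. complex_eigenvalue A z \<Longrightarrow> cmod z < 1"
    and a: "a > 0" and d: "d < - ((\<Sum>k\<le>n - 2. a ^ k) / a ^ (n - 2))"
  shows "\<exists>Z. RL_cycle (pl_map a d \<mu> A b e h) n Z"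
proof -
  \<comment> \<open>The \<open>n - 1 = m + 1\<close> left points will have first coordinates
    \<open>g 0\<close> to \<open>g m\<close>.\<close>
  obtain m where m: "n = m + 2" using n by (metis add.commute le_Suc_ex)
  define S where "S = (\<Sum>k\<le>m. a ^ k)"
  have S0: "S \<ge> 0" unfolding S_def using a by (intro sum_nonneg) simp
  have "d * a ^ m < - S" using d a by (simp add: m S_def field_simps)
  then have D: "a ^ (m + 1) * d < - a * S"
    using mult_strict_left_mono[OF _ a, of "d * a ^ m" "- S"] by (simp add: ac_simps)
  define D where "D = 1 - a ^ (m + 1) * d"
  have D1: "D > 1 + a * S" using D by (simp add: D_def)
  have D0: "1 + a * S > 0" using a S0 by (intro add_pos_nonneg) simp_all
  define x1 where "x1 = \<mu> * (1 + a * S) / D"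
  have x1: "x1 > 0" "x1 < \<mu>" using \<mu> D0 D1 by (simp_all add: x1_def divide_simps)
  \<comment> \<open>\<open>x1\<close> solves \<open>x = a ^ (n - 1) * (d * x + \<mu>) + \<mu> * (\<Sum>j<n - 1. a ^ j)\<close>; the upper bound on \<open>d\<close>
    says precisely that \<open>x1 < \<mu>\<close>, i.e. that its preimage under the left branch is negative.\<close>
  define g where "g k = a ^ k * (d * x1 + \<mu>) + \<mu> * (\<Sum>j<k. a ^ j)" for k
  have g0: "g 0 = d * x1 + \<mu>" by (simp add: g_def)
  have gS: "g (Suc k) = a * g k + \<mu>" for k
    by (simp add: g_def algebra_simps sum.lessThan_Suc_shift sum_distrib_left del: sum.lessThan_Suc)
  have gm: "g (Suc m) = x1"
  proof -
    have "g (Suc m) = a ^ (m + 1) * d * x1 + \<mu> * (\<Sum>j\<le>Suc m. a ^ j)"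
      by (simp add: g_def algebra_simps lessThan_Suc_atMost)
    also have "(\<Sum>j\<le>Suc m. a ^ j) = 1 + a * S"
      by (simp add: S_def sum.atMost_Suc_shift sum_distrib_left del: sum.atMost_Suc)
    also have "\<mu> * (1 + a * S) = D * x1" using D0 D1 by (simp add: x1_def)
    finally show ?thesis by (simp add: D_def algebra_simps)
  qed
  \<comment> \<open>Signs propagate backwards from \<open>g (Suc m) = x1 < \<mu>\<close>: as
    \<open>a * g k = g (Suc k) - \<mu>\<close>, a negative \<open>g (Suc k)\<close> makes
    \<open>g k\<close> negative.\<close>
  have gneg: "g k < 0" if "k \<le> m" for k
    using that
  proof (induction rule: inc_induct)
    case base
    have "a * g m < 0" using gm gS[of m] x1 by simp
    then show ?case using a by (simp add: mult_less_0_iff)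
  next
    case (step k)
    then have "a * g k < 0" using gS[of k] \<mu> by simp
    then show ?case using a by (simp add: mult_less_0_iff)
  qed
  \<comment> \<open>Index 0 is the right point, so \<open>x n = g (Suc m) = x1\<close> closes the
    cycle. The cycle itself is indexed from 1, hence \<open>i - 1\<close> below.\<close>
  define x where "x k = (case k of 0 \<Rightarrow> x1 | Suc j \<Rightarrow> g j)" for k
  define u where "u k = x k *\<^sub>R (if k = 0 then e else b) + h" for k
  obtain y where y: "\<And>k. y (Suc k) = A *v y k + u k" "y n = y 0"
    using affine_recurrence_periodic_point[of n A u] n ev by auto
  have step: "pl_map a d \<mu> A b e h (x k, y k) = (x (Suc k), y (Suc k))" if "k < n" for k
  proof (cases k)
    case 0
    then show ?thesis using x1 by (simp add: pl_map_def pl_f_def pl_G_def x_def y(1) u_def g0)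
  next
    case (Suc j)
    then have "g j < 0" using that m by (intro gneg) simp
    then show ?thesis using Suc by (simp add: pl_map_def pl_f_def pl_G_def x_def y(1) u_def gS)
  qed
  have "RL_cycle (pl_map a d \<mu> A b e h) n (\<lambda>i. (x (i - 1), y (i - 1)))"
    unfolding RL_cycle_def
  proof (intro conjI ballI)
    fix i assume "i \<in> {1..<n}"
    then show "pl_map a d \<mu> A b e h (x (i - 1), y (i - 1)) = (x (i + 1 - 1), y (i + 1 - 1))"
      using step[of "i - 1"] by auto
  next
    show "pl_map a d \<mu> A b e h (x (n - 1), y (n - 1)) = (x (1 - 1), y (1 - 1))"
      using step[of "n - 1"] n y(2) gm by (simp add: x_def m)
  next
    fix i assume i: "i \<in> {2..n}"
    then have "i - 1 = Suc (i - 2)" "i - 2 \<le> m" using m by auto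
    then show "fst (x (i - 1), y (i - 1)) < 0" using gneg by (simp add: x_def)
  qed (use x1 in \<open>simp add: x_def\<close>)
  then show ?thesis by blast
qed

text \<open>The existence conjunct keeps the stability conjunct from being vacuous. The lower bound
  on \<open>d\<close> puts the multiplier \<open>a ^ (n - 1) * d\<close> above -1; the upper bound
  makes it negative and yields existence.\<close>

theorem corollary1:
  fixes n :: nat and a d \<mu> :: real
    and A :: "real^'m^'m" and b e h :: "real^'m"
  assumes "n \<ge> 3"
    and "\<mu> > 0"
    and "\<And>z. complex_eigenvalue A z \<Longrightarrow> cmod z < 1"
    and "(a, d) \<in> RL_stability_region n"
  shows "(\<exists>Z. RL_cycle (pl_map a d \<mu> A b e h) n Z) \<and>
         (\<forall>Z. RL_cycle (pl_map a d \<mu> A b e h) n Z \<longrightarrow>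
              asymptotically_stable (pl_map a d \<mu> A b e h) (Z ` {1..n}))"
proof -
  have a: "a > 0" and d1: "- (1 / a ^ (n - 1)) < d"
    and d2: "d < - ((\<Sum>k\<le>n - 2. a ^ k) / a ^ (n - 2))"
    using assms(4) by (auto simp: RL_stability_region_def)
  have "(\<Sum>k\<le>n - 2. a ^ k) / a ^ (n - 2) \<ge> 0" using a by (intro divide_nonneg_nonneg sum_nonneg) simp_all
  then have "d < 0" using d2 by linarith
  then have "a ^ (n - 1) * d < 0" using a by (simp add: mult_pos_neg)
  moreover have "- 1 < a ^ (n - 1) * d" using d1 a by (simp add: field_simps)
  ultimately have "\<bar>a ^ (n - 1) * d\<bar> < 1" by simp
  then show ?thesis
    using RL_cycle_exists[of n \<mu> A a d b e h] RL_cycle_asymptotically_stable[of n A a d \<mu> b e h] assms a d2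
    by auto
qed

end
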